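(* Let $\mathcal{P}$ be a finite index set, $\{A_p : p\in\mathcal{P}\}$ a collection of real $n\times n$ matrices, each either stable or unstable, and $\mathcal{R}=\{R_{(p,q)} : p,q\in\mathcal{P}\}$ a collection of real $n\times n$ matrices. Suppose there exist a collection of symmetric positive definite matrices $\{Q_p\in M_n(\mathbb{R}) : p\in\mathcal{P}\}$ and positive constants $\lambda_p$ for $p\in\mathfrak{s}$, $\mu_p$ for $p\in\mathfrak{u}$, and $\gamma_{(q,p)}$ for $p,q\in\mathcal{P}$ (with $\gamma_{(q,p)}<1$ when $\mathfrak{s}=\emptyset$) satisfying $$Q_pA_p+A_p^\top Q_p\le-\lambda_pQ_p\ \text{ for all }p\in\mathfrak{s},\qquad Q_pA_p+A_p^\top Q_p\le\mu_pQ_p\ \text{ for all }p\in\mathfrak{u},$$ $$R_{(q,p)}^\top Q_pR_{(q,p)}\le\gamma_{(q,p)}Q_q\ \text{ for all }p,q\in\mathcal{P}.$$ Let $\gamma=\max_{p,q\in\mathcal{P}}\gamma_{(q,p)}$, and let $\{\tau_p\}_{p\in\mathfrak{s}}$, $\{\eta_p\}_{p\in\mathfrak{u}}$ be positive constants. Then the reset switched system $\dot x(t)=A_{\sigma(t)}x(t)$, $x(t_k)=R_{(\sigma(t_{k-1}),\sigma(t_k))}\,x(t_k^-)$ ($k\ge1$) is stable for any signal $\sigma\in\mathcal{S}^{M}\left(\{\tau_p\}_{p\in\mathfrak{s}},\{\eta_p\}_{p\in\mathfrak{u}}\right)$ satisfying $$\limsup_{t\to\infty}\left(-\sum_{p\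in\mathfrak{s}}\lambda_p\,N_s^p(0,t)\,\tau_p+\sum_{p\in\mathfrak{u}}\mu_p\,N_u^p(0,t)\,\eta_p+N(0,t)\ln\gamma\right)<0.$$
   Context: A real matrix is called stable if all its eigenvalues have negative real part, and unstable if at least one eigenvalue has positive real part; $\mathfrak{s},\mathfrak{u}\subseteq\mathcal{P}$ are the sets of indices $p$ with $A_p$ stable, resp. unstable. For symmetric matrices, $\le$ denotes the Loewner order. A switching signal is a right-continuous piecewise constant function $\sigma:[0,\infty)\to\mathcal{P}$ whose set of discontinuities $\{t_k\}_{k\ge1}$ (switching times) is an increasing sequence with $t_k\uparrow\infty$; put $t_0=0$. $\mathcal{S}^{M}(\{\tau_p\}_{p\in\mathfrak{s}},\{\eta_p\}_{p\in\mathfrak{u}})$ is the set of switching signals such that for all $k\ge0$: $t_{k+1}-t_k\ge\tau_{\sigma(t_k)}$ if $\sigma(t_k)\in\mathfrak{s}$, and $t_{k+1}-t_k\le\eta_{\sigma(t_k)}$ if $\sigma(t_k)\in\mathfrak{u}$. For $p\in\mathfrak{s}$, $N_s^p(0,t)=\#\{i : 0\le t_i<t,\ \sigma(t_i)=p\}$; for $p\in\mathfrak{u}$, $N_u^p(0,t)=\#\{i : 0\le t_i<t,\ \sigma(t_i)=p\}$; and $N(0,t)=\sum_{p\in\mathfrak{s}}N_s^p(0,t)+\sum_{p\in\mathfrak{u}}N_u^p(0,t)$. In the reset switched system, $\dot x=A_{\sigma(t)}x$ holds on each $[t_{k-1},t_k)$ and $x(t_k^-)=\lim_{t\to t_k^-}x(t)$.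 The system (for fixed $\sigma$) is stable if for every $\epsilon>0$ there is $\delta>0$ such that $\|x(0)\|<\delta$ implies $\|x(t)\|<\epsilon$ for all $t>0$ (Euclidean norm). *)

theory Defs
  imports "HOL-Analysis.Analysis"
begin

(* Eigenvalues of a real matrix are its complex eigenvalues. *)

definition eigenvalues :: "real^'n^'n \<Rightarrow> complex set" where
  "eigenvalues M =
     {z. \<exists>v :: complex^'n. v \<noteq> 0 \<and> map_matrix complex_of_real M *v v = z *s v}"

definition stable_matrix :: "real^'n^'n \<Rightarrow> bool" where
  "stable_matrix M \<longleftrightarrow> (\<forall>z \<in> eigenvalues M. Re z < 0)"

definition unstable_matrix :: "real^'n^'n \<Rightarrow> bool" where
  "unstable_matrix M \<longleftrightarrow> (\<exists>z \<in> eigenvalues M. Re z > 0)"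

definition stable_indices :: "('p \<Rightarrow> real^'n^'n) \<Rightarrow> 'p set" where
  "stable_indices A = {p. stable_matrix (A p)}"

definition unstable_indices :: "('p \<Rightarrow> real^'n^'n) \<Rightarrow> 'p set" where
  "unstable_indices A = {p. unstable_matrix (A p)}"

definition positive_definite :: "real^'n^'n \<Rightarrow> bool" where
  "positive_definite M \<longleftrightarrow> transpose M = M \<and> (\<forall>v. v \<noteq> 0 \<longrightarrow> 0 < v \<bullet> (M *v v))"

definition positive_semidefinite :: "real^'n^'n \<Rightarrow> bool" where
  "positive_semidefinite M \<longleftrightarrow> transpose M = M \<and> (\<forall>v. 0 \<le> v \<bullet> (M *v v))"

definition loewner_le :: "real^'n^'n \<Rightarrow> real^'n^'n \<Rightarrow> bool" (infix "\<preceq>\<^sub>L" 50) where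
  "X \<preceq>\<^sub>L Y \<longleftrightarrow> positive_semidefinite (Y - X)"

(* Signals live on [0,\<infinity>) and take values in a finite, hence discrete, set: continuity
   at s means being constant near s. Values at negative times are irrelevant. *)

definition discontinuities :: "(real \<Rightarrow> 'p) \<Rightarrow> real set" where
  "discontinuities \<sigma> = {s. 0 \<le> s \<and> \<not> (\<forall>\<^sub>F u in at s within {0..}. \<sigma> u = \<sigma> s)}"

(* The sequence t is determined by \<sigma>: t 0 = 0, and t 1 < t 2 < ... enumerates
   the discontinuities of \<sigma>. *)

definition switching_signal :: "(real \<Rightarrow> 'p) \<Rightarrow> (nat \<Rightarrow> real) \<Rightarrow> bool" where
  "switching_signal \<sigma> t \<longleftrightarrow>
     (\<forall>s\<ge>0. \<forall>\<^sub>F u in at_right s. \<sigma> u = \<sigma> s) \<and>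
     (\<forall>k. \<forall>s \<in> {t k..<t (Suc k)}. \<sigma> s = \<sigma> (t k)) \<and>
     t 0 = 0 \<and> strict_mono t \<and> filterlim t at_top sequentially \<and>
     discontinuities \<sigma> = t ` {1..}"

(* The class of signals obeying minimal dwell times \<tau> in the modes of S and maximal
   dwell times \<eta> in the modes of U; each signal comes paired with its switching times. *)

definition signal_class ::
  "'p set \<Rightarrow> 'p set \<Rightarrow> ('p \<Rightarrow> real) \<Rightarrow> ('p \<Rightarrow> real) \<Rightarrow> ((real \<Rightarrow> 'p) \<times> (nat \<Rightarrow> real)) set" where
  "signal_class S U \<tau> \<eta> =
     {(\<sigma>, t). switching_signal \<sigma> t \<and>
        (\<forall>k. (\<sigma> (t k) \<in> S \<longrightarrow> \<tau> (\<sigma> (t k)) \<le> t (Suc k) - t k) \<and>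
             (\<sigma> (t k) \<in> U \<longrightarrow> t (Suc k) - t k \<le> \<eta> (\<sigma> (t k))))}"

definition activations :: "(real \<Rightarrow> 'p) \<Rightarrow> (nat \<Rightarrow> real) \<Rightarrow> 'p \<Rightarrow> real \<Rightarrow> nat" where
  "activations \<sigma> t p T = card {i. 0 \<le> t i \<and> t i < T \<and> \<sigma> (t i) = p}"

definition total_activations ::
  "'p set \<Rightarrow> 'p set \<Rightarrow> (real \<Rightarrow> 'p) \<Rightarrow> (nat \<Rightarrow> real) \<Rightarrow> real \<Rightarrow> nat" where
  "total_activations S U \<sigma> t T =
     (\<Sum>p\<in>S. activations \<sigma> t p T) + (\<Sum>p\<in>U. activations \<sigma> t p T)"

(* At the left endpoint t k, "at s within {t k..<t (Suc k)}" gives the one-sided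
   derivative, so in particular x is right-continuous at switching times. *)

definition reset_solution ::
  "('p \<Rightarrow> real^'n^'n) \<Rightarrow> ('p \<times> 'p \<Rightarrow> real^'n^'n) \<Rightarrow> (real \<Rightarrow> 'p) \<Rightarrow> (nat \<Rightarrow> real)
     \<Rightarrow> (real \<Rightarrow> real^'n) \<Rightarrow> bool" where
  "reset_solution A R \<sigma> t x \<longleftrightarrow>
     (\<forall>k. \<forall>s \<in> {t k..<t (Suc k)}.
        (x has_vector_derivative A (\<sigma> s) *v x s) (at s within {t k..<t (Suc k)})) \<and>
     (\<forall>k. \<exists>y. (x \<longlongrightarrow> y) (at_left (t (Suc k))) \<and>
        x (t (Suc k)) = R (\<sigma> (t k), \<sigma> (t (Suc k))) *v y)"

definition reset_system_stable ::
  "('p \<Rightarrow> real^'n^'n) \<Rightarrow> ('p \<times> 'p \<Rightarrow> real^'n^'n) \<Rightarrow> (real \<Rightarrow> 'p) \<Rightarrow> (nat \<Rightarrow> real) \<Rightarrow> bool" where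
  "reset_system_stable A R \<sigma> t \<longleftrightarrow>
     (\<forall>\<epsilon>>0. \<exists>\<delta>>0. \<forall>x. reset_solution A R \<sigma> t x \<longrightarrow> norm (x 0) < \<delta> \<longrightarrow> (\<forall>s>0. norm (x s) < \<epsilon>))"

end

theory Submission
  imports Defs
begin

text \<open>Along a solution, \<open>V(s) = x(s) \<bullet> (Q (\<sigma> s) *v x(s))\<close> is a multiple
  Lyapunov function: in mode \<open>p\<close> it grows at rate at most \<open>-\<lambda>\<^sub>p\<close> or \<open>\<mu>\<^sub>p\<close>, and a reset
  multiplies it by at most \<open>\<gamma>\<close>. With the dwell-time constraints,
  \<open>V(t\<^sub>k) \<le> V(0) exp L\<^sub>k\<close>, where \<open>L\<^sub>k\<close> is the expression under the limsup
  evaluated at \<open>T = t\<^sub>k\<close>. A negative limsup bounds \<open>L\<^sub>k\<close> from above, so \<open>V(t\<^sub>k)\<close> is at most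
  a constant times \<open>V(0)\<close>; between switching times \<open>V\<close> grows by at most a fixed factor.\<close>

section \<open>Scalar comparison and norm bounds for quadratic forms\<close>

lemma gronwall_halfopen:
  fixes V V' :: "real \<Rightarrow> real"
  assumes der: "\<And>s. s \<in> {a..<b} \<Longrightarrow> (V has_real_derivative V' s) (at s within {a..<b})"
    and le: "\<And>s. s \<in> {a..<b} \<Longrightarrow> V' s \<le> c * V s"
    and s: "s \<in> {a..<b}"
  shows "V s \<le> V a * exp (c * (s - a))"
proof -
  \<comment> \<open>The integrating factor turns \<open>V' u \<le> c * V u\<close> into a
    nonpositive derivative of \<open>W\<close> in the interior. At \<open>a\<close> only a one-sided
    derivative is given, so continuity takes over there.\<close>
  define W where "W = (\<lambda>u. exp (- c * (u - a)) * V u)"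
  have "W s \<le> W a"
  proof (rule DERIV_nonpos_imp_decreasing_open[where f = W])
    show "a \<le> s" using s by simp
    fix u assume u: "a < u" "u < s"
    have "at u within {a..<b} = at u"
      using u s by (intro at_within_interior) simp
    with der[of u] u s have "(V has_real_derivative V' u) (at u)" by simp
    then have "(W has_real_derivative exp (- c * (u - a)) * (V' u - c * V u)) (at u)"
      unfolding W_def by (auto intro!: derivative_eq_intros simp: algebra_simps)
    moreover have "exp (- c * (u - a)) * (V' u - c * V u) \<le> 0"
      using le[of u] u s by (intro mult_nonneg_nonpos) auto
    ultimately show "\<exists>y. (W has_real_derivative y) (at u) \<and> y \<le> 0" by blast
  next
    have "continuous_on {a..<b} V"
      using der by (meson DERIV_continuous continuous_on_eq_continuous_within)
    then have "continuous_on {a..s} V"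
      using s by (auto elim: continuous_on_subset)
    then show "continuous_on {a..s} W" unfolding W_def by (intro continuous_intros)
  qed
  then have "exp (- (c * (s - a))) * V s \<le> V a" by (simp add: W_def)
  then show ?thesis by (simp add: exp_minus divide_simps mult_ac)
qed

text \<open>The lower bound is the minimum over the compact unit sphere, extended by homogeneity;
  the upper bound is boundedness of the linear map.\<close>

lemma positive_definite_norm_bounds:
  fixes M :: "real^'n^'n"
  assumes "positive_definite M"
  shows "\<exists>C>0. \<forall>v. (norm v)\<^sup>2 \<le> C * (v \<bullet> (M *v v)) \<and> v \<bullet> (M *v v) \<le> C * (norm v)\<^sup>2"
proof -
  have pos: "0 < v \<bullet> (M *v v)" if "v \<noteq> 0" for v
    using assms that by (auto simp: positive_definite_def)
  have cont: "continuous_on (sphere 0 1) (\<lambda>v. v \<bullet> (M *v v))"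
    by (intro continuous_intros linear_continuous_on_compose[OF continuous_on_id]) auto
  obtain w :: "real^'n" where w: "w \<in> sphere 0 1"
    and wmin: "\<And>v. v \<in> sphere 0 1 \<Longrightarrow> w \<bullet> (M *v w) \<le> v \<bullet> (M *v v)"
    using continuous_attains_inf[OF compact_sphere _ cont] by auto
  define m where "m = w \<bullet> (M *v w)"
  have m: "m > 0" using w pos[of w] unfolding m_def by fastforce
  have low: "m * (norm v)\<^sup>2 \<le> v \<bullet> (M *v v)" for v
  proof (cases "v = 0")
    case False
    have "m \<le> (v /\<^sub>R norm v) \<bullet> (M *v (v /\<^sub>R norm v))"
      unfolding m_def using False by (intro wmin) simp
    also have "\<dots> = (v \<bullet> (M *v v)) / (norm v)\<^sup>2"
      by (simp add: matrix_vector_mult_scaleR divide_simps power2_eq_square)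
    finally show ?thesis using False by (simp add: field_simps)
  qed simp
  obtain K where K: "K > 0" "\<And>v. norm (M *v v) \<le> norm v * K"
    using bounded_linear.pos_bounded[OF matrix_vector_mul_bounded_linear[of M]] by blast
  have up: "v \<bullet> (M *v v) \<le> K * (norm v)\<^sup>2" for v
  proof -
    have "v \<bullet> (M *v v) \<le> norm v * norm (M *v v)" by (rule norm_cauchy_schwarz)
    also have "\<dots> \<le> norm v * (norm v * K)" by (intro mult_left_mono K) simp
    finally show ?thesis by (simp add: power2_eq_square mult_ac)
  qed
  \<comment> \<open>\<open>1 / m\<close> serves the first inequality and \<open>K\<close> the
    second; the sum serves both because the form and the squared norm are nonnegative.\<close>
  show ?thesis
  proof (intro exI[of _ "1 / m + K"] conjI allI)
    fix v
    have nn: "0 \<le> v \<bullet> (M *v v)" using pos[of v] by (cases "v = 0") auto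
    have "(norm v)\<^sup>2 \<le> 1 / m * (v \<bullet> (M *v v))"
      using low[of v] m by (simp add: field_simps)
    also have "\<dots> \<le> (1 / m + K) * (v \<bullet> (M *v v))"
      using K nn by (intro mult_right_mono) auto
    finally show "(norm v)\<^sup>2 \<le> (1 / m + K) * (v \<bullet> (M *v v))" .
    have "K * (norm v)\<^sup>2 \<le> (1 / m + K) * (norm v)\<^sup>2"
      using m by (intro mult_right_mono) auto
    with up[of v] show "v \<bullet> (M *v v) \<le> (1 / m + K) * (norm v)\<^sup>2" by linarith
  qed (use m K in \<open>simp add: add_pos_pos\<close>)
qed

text \<open>Turns the norm bounds for each \<open>Q p\<close> into one constant for all modes: by
  monotonicity the maximum of the individual constants works, and the inserted 1 makes it
  positive.\<close>

lemma finite_common_bound: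
  fixes P :: "'p::finite \<Rightarrow> real \<Rightarrow> bool"
  assumes "\<And>p. \<exists>C. P p C" and "\<And>p C D. P p C \<Longrightarrow> C \<le> D \<Longrightarrow> P p D"
  shows "\<exists>C>0. \<forall>p. P p C"
proof -
  obtain f where f: "\<And>p. P p (f p)" using assms(1) by metis
  have "f p \<le> Max (insert 1 (range f))" for p by (rule Max_ge) auto
  moreover have "(1::real) \<le> Max (insert 1 (range f))" by (rule Max_ge) auto
  ultimately show ?thesis
    using f assms(2) by (intro exI[of _ "Max (insert 1 (range f))"]) (auto, blast)
qed

section \<open>Loewner inequalities as inequalities between quadratic forms\<close>

lemma loewner_le_quadratic_form:
  assumes "X \<preceq>\<^sub>L Y"
  shows "v \<bullet> (X *v v) \<le> v \<bullet> (Y *v v)"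
  using assms
  by (simp add: loewner_le_def positive_semidefinite_def matrix_vector_mult_diff_rdistrib
      inner_diff_right)

text \<open>With \<open>v = x s\<close>, the right-hand side is what the product rule gives for the
  derivative of \<open>x s \<bullet> (Q *v x s)\<close> along the flow of \<open>A\<close>.\<close>

lemma dot_lyapunov:
  fixes Q A :: "real^'n^'n"
  assumes "transpose Q = Q"
  shows "v \<bullet> ((Q ** A + transpose A ** Q) *v v) = (A *v v) \<bullet> (Q *v v) + v \<bullet> (Q *v (A *v v))"
  using assms
  by (simp add: matrix_vector_mult_add_rdistrib inner_add_right
      flip: matrix_vector_mul_assoc)
    (metis dot_lmul_matrix inner_commute transpose_matrix_vector)

lemma dot_congruence:
  fixes Q R :: "real^'n^'n"
  shows "v \<bullet> ((transpose R ** Q ** R) *v v) = (R *v v) \<bullet> (Q *v (R *v v))"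
  by (simp flip: matrix_vector_mul_assoc)
    (metis dot_lmul_matrix inner_commute transpose_matrix_vector)

text \<open>Evaluating the Loewner inequality at \<open>x s\<close> bounds the derivative of the
  form by \<open>c\<close> times the form, so the scalar comparison applies. The sign of
  \<open>c\<close> is free, which covers stable and unstable modes alike.\<close>

lemma quadratic_form_decay:
  fixes Q A :: "real^'n^'n"
  assumes sym: "transpose Q = Q"
    and le: "Q ** A + transpose A ** Q \<preceq>\<^sub>L c *\<^sub>R Q"
    and der: "\<And>s. s \<in> {a..<b} \<Longrightarrow> (x has_vector_derivative A *v x s) (at s within {a..<b})"
    and s: "s \<in> {a..<b}"
  shows "x s \<bullet> (Q *v x s) \<le> (x a \<bullet> (Q *v x a)) * exp (c * (s - a))"
proof (rule gronwall_halfopen[OF _ _ s,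
      where V' = "\<lambda>s. (A *v x s) \<bullet> (Q *v x s) + x s \<bullet> (Q *v (A *v x s))"])
  fix u assume u: "u \<in> {a..<b}"
  have "((\<lambda>s. Q *v x s) has_vector_derivative Q *v (A *v x u)) (at u within {a..<b})"
    by (rule bounded_linear.has_vector_derivative[OF matrix_vector_mul_bounded_linear der[OF u]])
  from bounded_bilinear.has_vector_derivative[OF bounded_bilinear_inner der[OF u] this]
  show "((\<lambda>s. x s \<bullet> (Q *v x s)) has_real_derivative
      (A *v x u) \<bullet> (Q *v x u) + x u \<bullet> (Q *v (A *v x u))) (at u within {a..<b})"
    by (simp add: has_real_derivative_iff_has_vector_derivative add.commute)
  show "(A *v x u) \<bullet> (Q *v x u) + x u \<bullet> (Q *v (A *v x u)) \<le> c * (x u \<bullet> (Q *v x u))"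
    using loewner_le_quadratic_form[OF le, of "x u"]
    by (simp add: dot_lyapunov[OF sym] flip: scaleR_matrix_vector_assoc)
qed

text \<open>Double counting: a sum grouped by modes becomes a sum over dwell intervals. The strict
  \<open>t i < T\<close> in the count makes \<open>T = t k\<close> select exactly the indices
  \<open>i < k\<close>.\<close>

lemma sum_activations:
  fixes f :: "'p::finite \<Rightarrow> real"
  assumes "t 0 = 0" "strict_mono t"
  shows "(\<Sum>p\<in>S. f p * real (activations \<sigma> t p (t k)))
       = (\<Sum>i<k. if \<sigma> (t i) \<in> S then f (\<sigma> (t i)) else 0)"
proof -
  have nn: "0 \<le> t i" for i
    using assms by (metis le0 strict_mono_less_eq)
  have "real (activations \<sigma> t p (t k)) = (\<Sum>i<k. if \<sigma> (t i) = p then 1 else 0)" for p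
  proof -
    have "{i. 0 \<le> t i \<and> t i < t k \<and> \<sigma> (t i) = p} = {i \<in> {..<k}. \<sigma> (t i) = p}"
      using nn assms by (auto simp: strict_mono_less)
    then show ?thesis by (simp add: activations_def sum.If_cases Int_def)
  qed
  then have "(\<Sum>p\<in>S. f p * real (activations \<sigma> t p (t k)))
      = (\<Sum>p\<in>S. \<Sum>i<k. if \<sigma> (t i) = p then f p else 0)"
    by (simp add: sum_distrib_left if_distrib cong: if_cong)
  also have "\<dots> = (\<Sum>i<k. \<Sum>p\<in>S. if \<sigma> (t i) = p then f p else 0)"
    by (rule sum.swap)
  finally show ?thesis by (simp add: sum.delta)
qed

theorem theorem6p5:
  fixes A :: "'p::finite \<Rightarrow> real^'n^'n"
    and R :: "'p \<times> 'p \<Rightarrow> real^'n^'n"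
    and Q :: "'p \<Rightarrow> real^'n^'n"
    and lam mu \<tau> \<eta> :: "'p \<Rightarrow> real"
    and gam :: "'p \<times> 'p \<Rightarrow> real"
    and \<gamma> :: real
    and \<sigma> :: "real \<Rightarrow> 'p" and t :: "nat \<Rightarrow> real"
    and S U :: "'p set"
  defines "S \<equiv> stable_indices A" and "U \<equiv> unstable_indices A"
    and "\<gamma> \<equiv> Max {gam (q, p) | p q. True}"
  assumes "\<forall>p. stable_matrix (A p) \<or> unstable_matrix (A p)"
    and "\<forall>p. positive_definite (Q p)"
    and "\<forall>p\<in>S. lam p > 0" and "\<forall>p\<in>U. mu p > 0"
    and "\<forall>p q. gam (q, p) > 0"
    and "S = {} \<longrightarrow> (\<forall>p q. gam (q, p) < 1)"
    and "\<forall>p\<in>S. Q p ** A p + transpose (A p) ** Q p \<preceq>\<^sub>L - lam p *\<^sub>R Q p"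
    and "\<forall>p\<in>U. Q p ** A p + transpose (A p) ** Q p \<preceq>\<^sub>L mu p *\<^sub>R Q p"
    and "\<forall>p q. transpose (R (q, p)) ** Q p ** R (q, p) \<preceq>\<^sub>L gam (q, p) *\<^sub>R Q q"
    and "\<forall>p\<in>S. \<tau> p > 0" and "\<forall>p\<in>U. \<eta> p > 0"
    and "(\<sigma>, t) \<in> signal_class S U \<tau> \<eta>"
    and "Limsup at_top (\<lambda>T::real. ereal (
           - (\<Sum>p\<in>S. lam p * real (activations \<sigma> t p T) * \<tau> p)
           + (\<Sum>p\<in>U. mu p * real (activations \<sigma> t p T) * \<eta> p)
           + real (total_activations S U \<sigma> t T) * ln \<gamma>)) < 0"
  shows "reset_system_stable A R \<sigma> t"
proof -
  define form where "form p v = v \<bullet> (Q p *v v)" for p v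
  define V where "V x s = form (\<sigma> s) (x s)" for x s
  \<comment> \<open>\<open>c\<close> is the growth rate in a mode and \<open>h\<close> the
    worst-case exponent over a full dwell interval. \<open>L k\<close> collects the exponents of the
    first \<open>k\<close> intervals, with one \<open>ln \<gamma>\<close> for the reset that ends
    each; \<open>H\<close> dominates every single \<open>h p\<close>.\<close>
  define c where "c p = (if p \<in> S then - lam p else mu p)" for p
  define h where "h p = (if p \<in> S then - lam p * \<tau> p else mu p * \<eta> p)" for p
  define L where "L k = (\<Sum>i<k. h (\<sigma> (t i)) + ln \<gamma>)" for k
  define H where "H = (\<Sum>p\<in>UNIV. \<bar>h p\<bar>)"
  \<comment> \<open>Every matrix is stable or unstable and never both, so the case split on
    \<open>p \<in> S\<close> in \<open>c\<close> and \<open>h\<close> covers exactly the two kinds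
    of modes.\<close>
  have SU: "p \<in> U \<longleftrightarrow> p \<notin> S" for p
    using assms(4) unfolding S_def U_def stable_indices_def unstable_indices_def
    by (force simp: stable_matrix_def unstable_matrix_def)
  have sw: "switching_signal \<sigma> t"
    and dwell_S: "\<And>k. \<sigma> (t k) \<in> S \<Longrightarrow> \<tau> (\<sigma> (t k)) \<le> t (Suc k) - t k"
    and dwell_U: "\<And>k. \<sigma> (t k) \<in> U \<Longrightarrow> t (Suc k) - t k \<le> \<eta> (\<sigma> (t k))"
    using assms(15) by (auto simp: signal_class_def)
  have t0: "t 0 = 0" and mono: "strict_mono t" and lim: "filterlim t at_top sequentially"
    and const: "\<And>k s. s \<in> {t k..<t (Suc k)} \<Longrightarrow> \<sigma> s = \<sigma> (t k)"
    using sw by (auto simp: switching_signal_def)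
  have tSuc: "t k < t (Suc k)" for k
    using mono by (simp add: strict_mono_less)

  \<comment> \<open>Positivity, growth rates and resets of the quadratic forms\<close>
  have sym: "transpose (Q p) = Q p" for p
    using assms(5) by (auto simp: positive_definite_def)
  have form_nonneg: "0 \<le> form p v" for p v
    using assms(5) unfolding form_def positive_definite_def
    by (cases "v = 0") (auto intro: less_imp_le)
  have rate: "Q p ** A p + transpose (A p) ** Q p \<preceq>\<^sub>L c p *\<^sub>R Q p" for p
    using assms(10,11) SU[of p] by (auto simp: c_def)
  have "{gam (q, p) |p q. True} = range gam" by auto
  then have gam_le: "gam (q, p) \<le> \<gamma>" for p q
    unfolding \<gamma>_def by simp
  \<comment> \<open>Positivity gives \<open>exp (ln \<gamma>) = \<gamma>\<close>, so a reset adds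
    \<open>ln \<gamma>\<close> to the exponent.\<close>
  then have \<gamma>_pos: "\<gamma> > 0"
    using assms(8) by (meson less_le_trans)
  have reset: "form p (R (q, p) *v y) \<le> \<gamma> * form q y" for p q y
  proof -
    have "form p (R (q, p) *v y) \<le> gam (q, p) * form q y"
      using loewner_le_quadratic_form[OF assms(12)[rule_format, of q p], of y]
      by (simp add: form_def dot_congruence flip: scaleR_matrix_vector_assoc)
    also have "\<dots> \<le> \<gamma> * form q y"
      by (intro mult_right_mono gam_le form_nonneg)
    finally show ?thesis .
  qed

  \<comment> \<open>Exponents over full and partial dwell intervals\<close>
  have dwell: "c (\<sigma> (t k)) * (t (Suc k) - t k) \<le> h (\<sigma> (t k))" for k
  proof (cases "\<sigma> (t k) \<in> S")
    case True
    \<comment> \<open>In a stable mode the rate is negative, so the shortest admissible dwell is the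
      worst case; in an unstable mode the rate is positive and the longest one is.\<close>
    then show ?thesis
      using dwell_S[OF True] assms(6) by (auto simp: c_def h_def intro: mult_left_mono)
  next
    case False
    then have u: "\<sigma> (t k) \<in> U" by (simp add: SU)
    with False show ?thesis
      using dwell_U[OF u] assms(7) by (auto simp: c_def h_def intro!: mult_left_mono)
  qed
  \<comment> \<open>The elapsed part of a stable interval may be shorter than the minimal dwell
    time, so only the sign of the rate helps there; in an unstable mode the full interval gives the
    bound. \<open>H\<close> does not depend on \<open>k\<close>.\<close>
  have dwell_H: "c (\<sigma> (t k)) * (s - t k) \<le> H" if s: "s \<in> {t k..<t (Suc k)}" for k s
  proof (cases "\<sigma> (t k) \<in> S")
    case True
    have "c (\<sigma> (t k)) * (s - t k) \<le> 0"
      using True assms(6) s by (intro mult_nonpos_nonneg) (auto simp: c_def less_imp_le)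
    also have "0 \<le> H" by (simp add: H_def sum_nonneg)
    finally show ?thesis .
  next
    case False
    then have "0 \<le> c (\<sigma> (t k))" using assms(7) by (auto simp: c_def SU less_imp_le)
    then have "c (\<sigma> (t k)) * (s - t k) \<le> c (\<sigma> (t k)) * (t (Suc k) - t k)"
      using s by (intro mult_left_mono) auto
    also have "\<dots> \<le> \<bar>h (\<sigma> (t k))\<bar>" using dwell[of k] by linarith
    also have "\<dots> \<le> H" unfolding H_def by (rule member_le_sum) auto
    finally show ?thesis .
  qed

  \<comment> \<open>The exponent at the switching times and its upper bound\<close>
  have L_eq: "- (\<Sum>p\<in>S. lam p * real (activations \<sigma> t p (t k)) * \<tau> p)
      + (\<Sum>p\<in>U. mu p * real (activations \<sigma> t p (t k)) * \<eta> p)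
      + real (total_activations S U \<sigma> t (t k)) * ln \<gamma> = L k" for k
  proof -
    have a: "(\<Sum>p\<in>S. lam p * real (activations \<sigma> t p (t k)) * \<tau> p)
        = (\<Sum>i<k. if \<sigma> (t i) \<in> S then lam (\<sigma> (t i)) * \<tau> (\<sigma> (t i)) else 0)"
      using sum_activations[OF t0 mono, of "\<lambda>p. lam p * \<tau> p"] by (simp add: mult_ac)
    have b: "(\<Sum>p\<in>U. mu p * real (activations \<sigma> t p (t k)) * \<eta> p)
        = (\<Sum>i<k. if \<sigma> (t i) \<in> U then mu (\<sigma> (t i)) * \<eta> (\<sigma> (t i)) else 0)"
      using sum_activations[OF t0 mono, of "\<lambda>p. mu p * \<eta> p"] by (simp add: mult_ac)
    \<comment> \<open>\<open>S\<close> and \<open>U\<close> partition the modes, so each of the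
      first \<open>k\<close> intervals is counted once.\<close>
    have d: "real (total_activations S U \<sigma> t (t k)) = (\<Sum>i<k. 1)"
    proof -
      have "real (total_activations S U \<sigma> t (t k))
          = (\<Sum>i<k. (if \<sigma> (t i) \<in> S then 1 else 0) + (if \<sigma> (t i) \<in> U then 1 else 0))"
        using sum_activations[OF t0 mono, of "\<lambda>_. 1" \<sigma> k S]
          sum_activations[OF t0 mono, of "\<lambda>_. 1" \<sigma> k U]
        by (simp add: total_activations_def sum.distrib)
      also have "\<dots> = (\<Sum>i<k. 1)" by (rule sum.cong) (auto simp: SU)
      finally show ?thesis .
    qed
    show ?thesis
      unfolding a b d L_def sum_distrib_right sum_negf[symmetric] sum.distrib[symmetric]
      by (rule sum.cong) (auto simp: h_def SU)
  qed
  have "\<forall>\<^sub>F T in at_top. ereal (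
           - (\<Sum>p\<in>S. lam p * real (activations \<sigma> t p T) * \<tau> p)
           + (\<Sum>p\<in>U. mu p * real (activations \<sigma> t p T) * \<eta> p)
           + real (total_activations S U \<sigma> t T) * ln \<gamma>) < 0"
    using assms(16) by (rule Limsup_lessD)
  from eventually_compose_filterlim[OF this lim]
  have "\<forall>\<^sub>F k in sequentially. L k < 0"
    by (simp only: L_eq ereal_less)
  then obtain N where N: "\<And>k. N \<le> k \<Longrightarrow> L k < 0"
    by (auto simp: eventually_sequentially)
  \<comment> \<open>Only indices below \<open>N\<close> can have \<open>L k \<ge> 0\<close>; the sum
    of their absolute values dominates each of them.\<close>
  define B where "B = (\<Sum>k<N. \<bar>L k\<bar>)"
  have B: "L k \<le> B" for k
  proof (cases "N \<le> k")
    case True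
    then have "L k < 0" by (rule N)
    moreover have "0 \<le> B" by (simp add: B_def sum_nonneg)
    ultimately show ?thesis by linarith
  next
    case False
    have "\<bar>L k\<bar> \<le> B" unfolding B_def using False by (intro member_le_sum) auto
    then show ?thesis by linarith
  qed

  obtain C where C: "C > 0" "\<And>p v. (norm v)\<^sup>2 \<le> C * form p v" "\<And>p v. form p v \<le> C * (norm v)\<^sup>2"
  proof -
    have "\<exists>C>0. \<forall>p. \<forall>v. (norm v)\<^sup>2 \<le> C * form p v \<and> form p v \<le> C * (norm v)\<^sup>2"
    proof (rule finite_common_bound)
      show "\<exists>C. \<forall>v. (norm v)\<^sup>2 \<le> C * form p v \<and> form p v \<le> C * (norm v)\<^sup>2" for p
        using positive_definite_norm_bounds[of "Q p"] assms(5) unfolding form_def by blast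
      show "\<forall>v. (norm v)\<^sup>2 \<le> D * form p v \<and> form p v \<le> D * (norm v)\<^sup>2"
        if "\<forall>v. (norm v)\<^sup>2 \<le> C * form p v \<and> form p v \<le> C * (norm v)\<^sup>2" "C \<le> D" for p C D
        using that form_nonneg by (meson mult_right_mono order_trans zero_le_power2)
    qed
    then show ?thesis using that by blast
  qed

  \<comment> \<open>A growth bound uniform over all solutions\<close>
  have bound: "norm (x s) \<le> C * exp ((B + H) / 2) * norm (x 0)"
    if sol: "reset_solution A R \<sigma> t x" and s: "0 < s" for x s
  proof -
    have der: "(x has_vector_derivative A (\<sigma> (t k)) *v x u) (at u within {t k..<t (Suc k)})"
      if "u \<in> {t k..<t (Suc k)}" for k u
      using sol that const[OF that] by (force simp: reset_solution_def)
    \<comment> \<open>The form on the left is frozen at mode \<open>\<sigma> (t k)\<close>, so that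
      the inequality survives the left limit at \<open>t (Suc k)\<close>, where
      \<open>\<sigma>\<close> already has its next value.\<close>
    have V_flow: "form (\<sigma> (t k)) (x u) \<le> V x (t k) * exp (c (\<sigma> (t k)) * (u - t k))"
      if "u \<in> {t k..<t (Suc k)}" for k u
      unfolding V_def form_def by (rule quadratic_form_decay[OF sym rate der that])
    have V_reset: "V x (t (Suc k)) \<le> V x (t k) * exp (h (\<sigma> (t k)) + ln \<gamma>)" for k
    proof -
      obtain y where y: "(x \<longlongrightarrow> y) (at_left (t (Suc k)))"
        and xy: "x (t (Suc k)) = R (\<sigma> (t k), \<sigma> (t (Suc k))) *v y"
        using sol unfolding reset_solution_def by blast
      have "form (\<sigma> (t k)) y \<le> V x (t k) * exp (c (\<sigma> (t k)) * (t (Suc k) - t k))"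
      proof (rule tendsto_le[OF trivial_limit_at_left_real])
        show "((\<lambda>u. form (\<sigma> (t k)) (x u)) \<longlongrightarrow> form (\<sigma> (t k)) y) (at_left (t (Suc k)))"
          unfolding form_def
          by (intro tendsto_inner y bounded_linear.tendsto[OF matrix_vector_mul_bounded_linear])
        show "((\<lambda>u. V x (t k) * exp (c (\<sigma> (t k)) * (u - t k)))
            \<longlongrightarrow> V x (t k) * exp (c (\<sigma> (t k)) * (t (Suc k) - t k))) (at_left (t (Suc k)))"
          by (intro tendsto_intros)
        show "\<forall>\<^sub>F u in at_left (t (Suc k)).
            form (\<sigma> (t k)) (x u) \<le> V x (t k) * exp (c (\<sigma> (t k)) * (u - t k))"
          using eventually_at_left_real[OF tSuc[of k]]
          by eventually_elim (auto intro: V_flow)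
      qed
      also have "\<dots> \<le> V x (t k) * exp (h (\<sigma> (t k)))"
        using dwell[of k] by (intro mult_left_mono) (auto simp: V_def form_nonneg)
      finally have le: "form (\<sigma> (t k)) y \<le> V x (t k) * exp (h (\<sigma> (t k)))" .
      \<comment> \<open>One inequality absorbs both the jump of the state and the change of
        \<open>Q\<close> from the old mode to the new one.\<close>
      have "V x (t (Suc k)) \<le> \<gamma> * form (\<sigma> (t k)) y"
        by (simp add: V_def xy reset)
      also have "\<dots> \<le> \<gamma> * (V x (t k) * exp (h (\<sigma> (t k))))"
        using \<gamma>_pos by (intro mult_left_mono le) simp
      finally show ?thesis
        using \<gamma>_pos by (simp add: exp_add mult_ac)
    qed
    have V_L: "V x (t k) \<le> V x 0 * exp (L k)" for k
    proof (induction k)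
      case 0
      then show ?case by (simp add: L_def t0)
    next
      case (Suc k)
      have "V x (t (Suc k)) \<le> V x (t k) * exp (h (\<sigma> (t k)) + ln \<gamma>)" by (rule V_reset)
      also have "\<dots> \<le> V x 0 * exp (L k) * exp (h (\<sigma> (t k)) + ln \<gamma>)"
        by (intro mult_right_mono Suc) simp
      also have "\<dots> = V x 0 * exp (L (Suc k))" by (simp add: L_def exp_add mult_ac)
      finally show ?case .
    qed
    obtain k where k: "s \<in> {t k..<t (Suc k)}"
    proof -
      have "\<exists>n. s < t n"
        using filterlim_at_top_dense[THEN iffD1, OF lim]
        by (auto simp: eventually_sequentially)
      \<comment> \<open>Since \<open>t 0 = 0 < s\<close>, the least such \<open>n\<close> is a
        successor, and its predecessor indexes the interval containing \<open>s\<close>.\<close>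
      define n where "n = (LEAST n. s < t n)"
      have n: "s < t n" unfolding n_def using \<open>\<exists>n. s < t n\<close> by (rule LeastI_ex)
      then obtain k where "n = Suc k" using t0 s by (cases n) auto
      moreover from this have "\<not> s < t k" unfolding n_def by (metis lessI not_less_Least)
      ultimately show ?thesis using n that[of k] by auto
    qed
    have "V x s \<le> V x (t k) * exp (c (\<sigma> (t k)) * (s - t k))"
      using V_flow[OF k] const[OF k] by (simp add: V_def)
    also have "\<dots> \<le> V x (t k) * exp H"
      using dwell_H[OF k] by (intro mult_left_mono) (auto simp: V_def form_nonneg)
    also have "\<dots> \<le> V x 0 * exp (L k) * exp H"
      by (intro mult_right_mono V_L) simp
    also have "\<dots> \<le> V x 0 * exp B * exp H"
      using B[of k] by (intro mult_right_mono mult_left_mono) (auto simp: V_def form_nonneg)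
    also have "\<dots> \<le> C * (norm (x 0))\<^sup>2 * exp B * exp H"
      unfolding V_def by (intro mult_right_mono C) auto
    finally have Vs: "V x s \<le> C * (norm (x 0))\<^sup>2 * exp B * exp H" .
    \<comment> \<open>The norm comparison enters once at time 0 and once here; taking the square
      root leaves a single \<open>C\<close> and halves \<open>B + H\<close>.\<close>
    have "(norm (x s))\<^sup>2 \<le> C * V x s"
      unfolding V_def by (rule C)
    also have "\<dots> \<le> C * (C * (norm (x 0))\<^sup>2 * exp B * exp H)"
      using Vs C(1) by simp
    also have "\<dots> = (C * exp ((B + H) / 2) * norm (x 0))\<^sup>2"
      by (simp add: power_mult_distrib power2_eq_square mult_ac flip: exp_add)
    finally show ?thesis
      by (rule power2_le_imp_le) (use C(1) in auto)
  qed
  \<comment> \<open>\<open>K\<close> depends on neither \<open>x\<close> nor \<open>s\<close>, so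
    \<open>\<epsilon> / K\<close> serves as \<open>\<delta>\<close> for all solutions at
    once.\<close>
  define K where "K = C * exp ((B + H) / 2)"
  have K: "K > 0" using C(1) by (simp add: K_def)
  show ?thesis
    unfolding reset_system_stable_def
  proof (intro allI impI)
    fix \<epsilon> :: real assume "\<epsilon> > 0"
    show "\<exists>\<delta>>0. \<forall>x. reset_solution A R \<sigma> t x \<longrightarrow> norm (x 0) < \<delta> \<longrightarrow> (\<forall>s>0. norm (x s) < \<epsilon>)"
    proof (intro exI[of _ "\<epsilon> / K"] conjI allI impI)
      fix x s assume "reset_solution A R \<sigma> t x" "norm (x 0) < \<epsilon> / K" "0 < (s::real)"
      then have "norm (x s) \<le> K * norm (x 0)" "K * norm (x 0) < \<epsilon>"
        using bound K by (auto simp: K_def field_simps)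
      then show "norm (x s) < \<epsilon>" by linarith
    qed (use K \<open>\<epsilon> > 0\<close> in simp)
  qed
qed

end
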